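(* Let $d\ge 1$ and let $X$ and $X_{\mathbf n}$, $\mathbf n\in\mathbb Z_+^d$, be real-valued random variables on a probability space $(\Omega,\mathcal F,P)$ (no assumption is made on their dependence). Assume there is a constant $M>0$ such that $$\frac{1}{|\mathbf n|}\sum_{\mathbf k\preceq \mathbf n}P(|X_{\mathbf k}|>x)\le M\,P(|X|>x)\qquad\text{for all } x\ge 0 \text{ and all } \mathbf n\in\mathbb Z_+^d .$$ If $E|X|<\infty$, then $$\lim_{\max\{n_1,\dots,n_d\}\to\infty}\frac{S_{\mathbf n}(t)}{|\mathbf n|}=0\quad\text{in the } L_1(\tilde\Omega)\text{-norm},$$ i.e. $\int_{\tilde\Omega}\frac{|S_{\mathbf n}(t)|}{|\mathbf n|}\,d\tilde P\to 0$ as $\max\{n_1,\dots,n_d\}\to\infty$.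
   Context: $\mathbb Z_+^d$ is the set of $d$-dimensional lattice points with positive integer coordinates. For $\mathbf k,\mathbf n\in\mathbb Z_+^d$, $\mathbf k\preceq\mathbf n$ means $k_i\le n_i$ for all $1\le i\le d$, and $|\mathbf n|=n_1n_2\cdots n_d$. $\mathbb T=[-\pi,\pi)$. For $t=(t_1,\dots,t_d)\in\mathbb T^d$, $\mathbf k\cdot t=k_1t_1+\cdots+k_dt_d$, and the discrete Fourier transform is $S_{\mathbf n}(t)=\sum_{\mathbf k\preceq\mathbf n}e^{i\mathbf k\cdot t}X_{\mathbf k}$. $L$ denotes Lebesgue measure on $\mathbb T^d$, $\tilde\Omega=\Omega\times\mathbb T^d$, and $\tilde P=P\times L$ is the product measure on $\tilde\Omega$. *)

theory Defs
  imports "HOL-Probability.Probability"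
begin

text \<open>The dimension is \<open>CARD('d)\<close> for a finite index type \<open>'d\<close>; since types are nonempty, it is
  at least 1, and every positive dimension arises.\<close>

definition pos_lattice :: "(nat ^ 'd) set" where
  "pos_lattice = {n. \<forall>i. 0 < n $ i}"

definition lattice_below :: "nat ^ 'd \<Rightarrow> (nat ^ 'd) set" where
  "lattice_below n = {k \<in> pos_lattice. \<forall>i. k $ i \<le> n $ i}"

definition lattice_size :: "nat ^ 'd::finite \<Rightarrow> nat" where
  "lattice_size n = (\<Prod>i\<in>UNIV. n $ i)"

definition lattice_dot :: "nat ^ 'd::finite \<Rightarrow> real ^ 'd \<Rightarrow> real" where
  "lattice_dot k t = (\<Sum>i\<in>UNIV. real (k $ i) * t $ i)"

definition torus :: "(real ^ 'd) set" where
  "torus = {t. \<forall>i. - pi \<le> t $ i \<and> t $ i < pi}"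

definition DFT :: "(nat ^ 'd::finite \<Rightarrow> 'a \<Rightarrow> real) \<Rightarrow> nat ^ 'd \<Rightarrow> 'a \<Rightarrow> real ^ 'd \<Rightarrow> complex" where
  "DFT X n \<omega> t = (\<Sum>k\<in>lattice_below n. exp (\<i> * complex_of_real (lattice_dot k t)) * complex_of_real (X k \<omega>))"

text \<open>Lebesgue measure on the torus is not normalised: the torus has measure \<open>(2 * pi) ^ CARD('d)\<close>.\<close>

definition torus_product :: "'a measure \<Rightarrow> ('a \<times> (real ^ 'd::finite)) measure" where
  "torus_product P = P \<Otimes>\<^sub>M lebesgue_on torus"

text \<open>The filter of \<open>max {n\<^sub>1, \<dots>, n\<^sub>d} \<rightarrow> \<infinity>\<close> on the positive lattice: only the largest coordinate is
  required to grow, in contrast to \<open>min {n\<^sub>1, \<dots>, n\<^sub>d} \<rightarrow> \<infinity>\<close>.\<close>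

definition max_at_top :: "(nat ^ 'd::finite) filter" where
  "max_at_top = inf (filtercomap (\<lambda>n. Max (range (\<lambda>i. n $ i))) at_top) (principal pos_lattice)"

end

(* Clamp every X_k to the interval [-A, A]. By Parseval on the torus the clamped sum has L_2(T^d)-norm
   at most const * A * sqrt |n|, uniformly in omega, so after division by |n| it vanishes as |n| grows;
   and |n| >= max n_i. The excess |X_k| - A (positive part) is the integral of the indicator of
   |X_k| > x over x >= A, so the tail hypothesis bounds the average of the expected excesses by
   M * E(|X| - A)^+, which is small for large A because X is integrable. *)
theory Submission
  imports Defs
begin

section \<open>Orthogonality of characters on the torus\<close>

definition character :: "int ^ 'd::finite \<Rightarrow> real ^ 'd \<Rightarrow> complex" where
  "character m t = cis (\<Sum>i\<in>UNIV. of_int (m $ i) * t $ i)"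

text \<open>Lebesgue measure on a Euclidean space is the image of a product of real Lebesgue
  measures under the map that assembles a vector from its coordinates; on that product the integral
  factorises.\<close>

lemma integral_lborel_prod:
  fixes f :: "'a::euclidean_space \<Rightarrow> real \<Rightarrow> 'b::{real_normed_field,banach,second_countable_topology}"
  assumes f: "\<And>b. b \<in> Basis \<Longrightarrow> integrable lborel (f b)"
  shows "(LINT x|lborel. (\<Prod>b\<in>Basis. f b (x \<bullet> b))) = (\<Prod>b\<in>Basis. integral\<^sup>L lborel (f b))"
proof -
  interpret product_sigma_finite "\<lambda>_::'a. lborel :: real measure" ..
  have [measurable]: "f b \<in> borel_measurable borel" if "b \<in> Basis" for b
    using f[OF that] by (auto dest: borel_measurable_integrable)
  have "(LINT x|lborel. (\<Prod>b\<in>Basis. f b (x \<bullet> b))) =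
        (LINT g|Pi\<^sub>M Basis (\<lambda>_. lborel). (\<Prod>b\<in>Basis. f b ((\<Sum>c\<in>Basis. g c *\<^sub>R c) \<bullet> b)))"
    by (subst lborel_eq, rule integral_distr) auto
  also have "\<dots> = (LINT g|Pi\<^sub>M Basis (\<lambda>_. lborel). (\<Prod>b\<in>Basis. f b (g b)))"
    by (intro Bochner_Integration.integral_cong refl prod.cong) auto
  also have "\<dots> = (\<Prod>b\<in>Basis. integral\<^sup>L lborel (f b))"
    by (rule product_integral_prod) (auto intro: f)
  finally show ?thesis .
qed

lemma borel_measurable_cis [measurable]: "cis \<in> borel_measurable borel"
  by (rule borel_measurable_continuous_onI) (auto intro: continuous_intros)

lemma integrable_cis_period: "integrable lborel (\<lambda>x. indicator {- pi..<pi} x *\<^sub>R cis (of_int m * x))"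
  by (rule integrableI_bounded_set_indicator[where B = 1]) auto

text \<open>The antiderivative \<open>cis (m x) / (i m)\<close> exists because m is nonzero, and
  takes the same value at both ends of the period because m is an integer.\<close>

lemma integral_cis_period:
  assumes "m \<noteq> 0"
  shows "(LINT x|lborel. indicator {- pi..<pi} x *\<^sub>R cis (of_int m * x)) = 0"
proof -
  let ?F = "\<lambda>x. cis (of_int m * x) / (\<i> * of_int m)"
  have deriv: "(?F has_vector_derivative cis (of_int m * x)) (at x within {- pi..pi})" for x
  proof -
    have "((\<lambda>x. exp (\<i> * of_int m * x) / (\<i> * of_int m)) has_field_derivative exp (\<i> * of_int m * of_real x))
       (at (of_real x))"
      using assms by (auto intro!: derivative_eq_intros)
    from has_vector_derivative_real_field[OF this]
    show ?thesis by (simp add: cis_conv_exp mult_ac has_vector_derivative_at_within)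
  qed
  \<comment> \<open>The fundamental theorem of calculus is applied on a closed interval; adding the
    endpoint pi changes the half-open one by a null set.\<close>
  have "AE x in lborel. x \<noteq> pi" by (rule AE_lborel_singleton)
  then have "(LINT x|lborel. indicator {- pi..<pi} x *\<^sub>R cis (of_int m * x)) =
        (LINT x|lborel. indicator {- pi..pi} x *\<^sub>R cis (of_int m * x))"
    by (intro integral_cong_AE) (auto elim!: eventually_mono split: split_indicator)
  also have "\<dots> = ?F pi - ?F (- pi)"
    by (rule integral_FTC_Icc[OF _ deriv]) (auto intro!: continuous_intros)
  \<comment> \<open>The two arguments differ by 2 pi m, a multiple of the full period.\<close>
  also have "cis (of_int m * pi) = cis (of_int m * - pi)"
    using cis_mult[of "of_int m * - pi" "2 * pi * of_int m"] cis_multiple_2pi[of "of_int m"]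
    by (simp add: algebra_simps)
  finally show ?thesis by simp
qed

lemma torus_borel [measurable]: "(torus :: (real ^ 'd::finite) set) \<in> sets borel"
proof -
  have "(torus :: (real ^ 'd::finite) set) = {t \<in> space borel. \<forall>i. - pi \<le> t $ i \<and> t $ i < pi}"
    by (auto simp: torus_def)
  also have "\<dots> \<in> sets borel"
    by measurable
  finally show ?thesis .
qed

lemma finite_measure_torus: "finite_measure (lebesgue_on (torus :: (real ^ 'd::finite) set))"
proof (rule finite_measure_lebesgue_on, rule bounded_set_imp_lmeasurable)
  have "(torus :: (real ^ 'd::finite) set) \<subseteq> cbox (\<chi> i. - pi) (\<chi> i. pi)"
    by (auto simp: torus_def mem_box_cart less_imp_le)
  then show "bounded (torus :: (real ^ 'd::finite) set)"
    using bounded_cbox bounded_subset by blast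
qed simp

lemma measurable_lebesgue_on_if_borel:
  assumes "f \<in> borel_measurable borel"
  shows "f \<in> borel_measurable (lebesgue_on S)"
  using assms by (intro measurable_restrict_space1 measurable_completion) simp

text \<open>Both the indicator of the torus and the character split into one-variable factors, so
  the integral is a product over coordinates; any coordinate with nonzero frequency contributes a
  factor 0.\<close>

lemma integral_torus_character:
  fixes m :: "int ^ 'd::finite"
  assumes "m \<noteq> 0"
  shows "(LINT t|lebesgue_on torus. character m t) = 0"
proof -
  define f where "f i x = indicator {- pi..<pi} x *\<^sub>R cis (of_int (m $ i) * x)" for i x
  \<comment> \<open>Factorisation over \<open>Basis\<close> needs factors indexed by basis vectors;
    \<open>THE\<close> recovers the coordinate index from the axis vector.\<close>
  define g where "g b = f (THE i. b = axis i (1::real))" for b :: "real ^ 'd"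
  have g: "g (axis i 1) = f i" for i
    by (simp add: g_def axis_eq_axis)
  have Basis: "(Basis :: (real ^ 'd) set) = (\<lambda>i. axis i 1) ` UNIV"
    by (auto simp: Basis_vec_def)
  have inj: "inj (\<lambda>i::'d. axis i (1::real))"
    by (auto simp: inj_on_def axis_eq_axis)
  have prod: "indicator torus t *\<^sub>R character m t = (\<Prod>b\<in>Basis. g b (t \<bullet> b))" for t
  proof -
    have "character m t = (\<Prod>i\<in>UNIV. cis (of_int (m $ i) * t $ i))"
      by (simp add: character_def cis_conv_exp sum_distrib_left exp_sum)
    then show ?thesis
      by (auto simp: Basis prod.reindex[OF inj] g inner_axis f_def torus_def split: split_indicator)
  qed
  obtain j where j: "m $ j \<noteq> 0"
    using assms by (auto simp: vec_eq_iff)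
  \<comment> \<open>The character is Borel, so passing from the completed measure to
    \<open>lborel\<close> leaves the integral unchanged.\<close>
  have "(LINT t|lebesgue_on torus. character m t) = (LINT t|lborel. indicator torus t *\<^sub>R character m t)"
    unfolding character_def by (subst integral_restrict_space) (auto intro!: integral_completion)
  also have "\<dots> = (\<Prod>b\<in>Basis. integral\<^sup>L lborel (g b))"
    unfolding prod
    by (rule integral_lborel_prod) (auto simp: Basis g f_def integrable_cis_period)
  also have "\<dots> = 0"
    using integral_cis_period[OF j] by (auto simp: Basis prod.reindex[OF inj] g f_def[abs_def])
  finally show ?thesis .
qed

section \<open>Tail probabilities and expected excesses\<close>

lemma nn_integral_layer_cake:
  assumes "sigma_finite_measure P" and [measurable]: "Y \<in> borel_measurable P"
  shows "(\<integral>\<^sup>+\<omega>. ennreal (\<bar>Y \<omega>\<bar> - A) \<partial>P) =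
         (\<integral>\<^sup>+x. indicator {A..} x * emeasure P {\<omega> \<in> space P. \<bar>Y \<omega>\<bar> > x} \<partial>lborel)"
proof -
  interpret sigma_finite_measure P by fact
  interpret pair_sigma_finite P "lborel :: real measure" ..
  have "(\<integral>\<^sup>+\<omega>. ennreal (\<bar>Y \<omega>\<bar> - A) \<partial>P) =
        (\<integral>\<^sup>+\<omega>. (\<integral>\<^sup>+x. indicator {A..} x * indicator {x. x < \<bar>Y \<omega>\<bar>} x \<partial>lborel) \<partial>P)"
  \<comment> \<open>The excess is the length of the interval from A to |Y|. When |Y| < A the
    interval is empty, which agrees with \<open>ennreal\<close> sending negative reals to 0.\<close>
  proof (rule nn_integral_cong)
    fix \<omega>
    have "(\<integral>\<^sup>+x. indicator {A..} x * indicator {x. x < \<bar>Y \<omega>\<bar>} x \<partial>lborel) =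
          (\<integral>\<^sup>+x. indicator {A..<\<bar>Y \<omega>\<bar>} x \<partial>lborel)"
      by (intro nn_integral_cong) (auto split: split_indicator)
    also have "\<dots> = ennreal (\<bar>Y \<omega>\<bar> - A)"
      by (cases "A \<le> \<bar>Y \<omega>\<bar>") (auto simp: ennreal_neg)
    finally show "ennreal (\<bar>Y \<omega>\<bar> - A) = (\<integral>\<^sup>+x. indicator {A..} x * indicator {x. x < \<bar>Y \<omega>\<bar>} x \<partial>lborel)" ..
  qed
  also have "\<dots> = (\<integral>\<^sup>+x. (\<integral>\<^sup>+\<omega>. indicator {A..} x * indicator {x. x < \<bar>Y \<omega>\<bar>} x \<partial>P) \<partial>lborel)"
    by (rule Fubini'[symmetric]) measurable
  also have "\<dots> = (\<integral>\<^sup>+x. indicator {A..} x * emeasure P {\<omega> \<in> space P. \<bar>Y \<omega>\<bar> > x} \<partial>lborel)"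
  proof (rule nn_integral_cong)
    fix x :: real
    have "(\<integral>\<^sup>+\<omega>. indicator {x. x < \<bar>Y \<omega>\<bar>} x \<partial>P) = (\<integral>\<^sup>+\<omega>. indicator {\<omega> \<in> space P. \<bar>Y \<omega>\<bar> > x} \<omega> \<partial>P)"
      by (intro nn_integral_cong) (auto split: split_indicator)
    then show "(\<integral>\<^sup>+\<omega>. indicator {A..} x * indicator {x. x < \<bar>Y \<omega>\<bar>} x \<partial>P) =
               indicator {A..} x * emeasure P {\<omega> \<in> space P. \<bar>Y \<omega>\<bar> > x}"
      by (simp add: nn_integral_cmult)
  qed
  finally show ?thesis .
qed

text \<open>The tail inequality is integrated over x from A to infinity, where every x is
  nonnegative since A is. In the application C is M times the number of lattice points.\<close>

lemma nn_integral_tail_sum_le: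
  fixes Y :: "'k \<Rightarrow> 'a \<Rightarrow> real"
  assumes "prob_space P" and [measurable]: "X \<in> borel_measurable P"
    and Y [measurable]: "\<And>k. k \<in> K \<Longrightarrow> Y k \<in> borel_measurable P"
    and le: "\<And>x. x \<ge> 0 \<Longrightarrow> (\<Sum>k\<in>K. \<P>(\<omega> in P. \<bar>Y k \<omega>\<bar> > x)) \<le> C * \<P>(\<omega> in P. \<bar>X \<omega>\<bar> > x)"
    and "A \<ge> 0" "C \<ge> 0"
  shows "(\<Sum>k\<in>K. \<integral>\<^sup>+\<omega>. ennreal (\<bar>Y k \<omega>\<bar> - A) \<partial>P) \<le> ennreal C * (\<integral>\<^sup>+\<omega>. ennreal (\<bar>X \<omega>\<bar> - A) \<partial>P)"
proof -
  interpret prob_space P by fact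
  have meas [measurable]: "(\<lambda>x. emeasure P {\<omega> \<in> space P. \<bar>Z \<omega>\<bar> > x}) \<in> borel_measurable borel"
    if [measurable]: "Z \<in> borel_measurable P" for Z :: "'a \<Rightarrow> real"
    by measurable
  have "(\<Sum>k\<in>K. \<integral>\<^sup>+\<omega>. ennreal (\<bar>Y k \<omega>\<bar> - A) \<partial>P) =
        (\<integral>\<^sup>+x. (\<Sum>k\<in>K. indicator {A..} x * emeasure P {\<omega> \<in> space P. \<bar>Y k \<omega>\<bar> > x}) \<partial>lborel)"
    by (subst nn_integral_sum) (auto simp: nn_integral_layer_cake[OF sigma_finite_measure_axioms])
  also have "\<dots> \<le> (\<integral>\<^sup>+x. ennreal C * (indicator {A..} x * emeasure P {\<omega> \<in> space P. \<bar>X \<omega>\<bar> > x}) \<partial>lborel)"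
  proof (rule nn_integral_mono)
    fix x :: real
    show "(\<Sum>k\<in>K. indicator {A..} x * emeasure P {\<omega> \<in> space P. \<bar>Y k \<omega>\<bar> > x}) \<le>
          ennreal C * (indicator {A..} x * emeasure P {\<omega> \<in> space P. \<bar>X \<omega>\<bar> > x})"
    proof (cases "A \<le> x")
      case True
      then have "ennreal (\<Sum>k\<in>K. \<P>(\<omega> in P. \<bar>Y k \<omega>\<bar> > x)) \<le> ennreal (C * \<P>(\<omega> in P. \<bar>X \<omega>\<bar> > x))"
        using \<open>A \<ge> 0\<close> by (intro ennreal_leI le) simp
      with True \<open>C \<ge> 0\<close> show ?thesis
        by (simp add: emeasure_eq_measure ennreal_mult)
    qed simp
  qed
  also have "\<dots> = ennreal C * (\<integral>\<^sup>+\<omega>. ennreal (\<bar>X \<omega>\<bar> - A) \<partial>P)"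
    by (subst nn_integral_cmult) (auto simp: nn_integral_layer_cake[OF sigma_finite_measure_axioms])
  finally show ?thesis .
qed

text \<open>Dominated convergence with majorant |X|: for fixed \<omega> the integrand is 0 once n
  reaches |X|.\<close>

lemma tendsto_tail_expectation:
  fixes X :: "'a \<Rightarrow> real"
  assumes "integrable P X"
  shows "(\<lambda>n. LINT \<omega>|P. max 0 (\<bar>X \<omega>\<bar> - real n)) \<longlonglongrightarrow> 0"
proof -
  have [measurable]: "X \<in> borel_measurable P" using assms by simp
  have "(\<lambda>n. LINT \<omega>|P. max 0 (\<bar>X \<omega>\<bar> - real n)) \<longlonglongrightarrow> (LINT \<omega>|P. 0)"
  proof (rule integral_dominated_convergence[where w = "\<lambda>\<omega>. \<bar>X \<omega>\<bar>"])
    show "AE \<omega> in P. (\<lambda>n. max 0 (\<bar>X \<omega>\<bar> - real n)) \<longlonglongrightarrow> 0"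
    proof (rule AE_I2)
      fix \<omega>
      obtain N :: nat where "\<bar>X \<omega>\<bar> \<le> real N"
        using real_arch_simple by blast
      then have "eventually (\<lambda>n. max 0 (\<bar>X \<omega>\<bar> - real n) = 0) sequentially"
        by (auto intro!: eventually_sequentiallyI[of N])
      then show "(\<lambda>n. max 0 (\<bar>X \<omega>\<bar> - real n)) \<longlonglongrightarrow> 0"
        by (rule tendsto_eventually)
    qed
  qed (use assms in auto)
  then show ?thesis by simp
qed

section \<open>Counting lattice points and the growth of their number\<close>

lemma finite_lattice_below: "finite (lattice_below (n :: nat ^ 'd::finite))"
proof -
  have "lattice_below n \<subseteq> vec_lambda ` (\<Pi>\<^sub>E i\<in>UNIV. {..n $ i})"
  proof
    fix k assume "k \<in> lattice_below n"
    then have "vec_nth k \<in> (\<Pi>\<^sub>E i\<in>UNIV. {..n $ i})"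
      by (auto simp: lattice_below_def)
    then show "k \<in> vec_lambda ` (\<Pi>\<^sub>E i\<in>UNIV. {..n $ i})"
      by (metis image_eqI vec_nth_inverse)
  qed
  then show ?thesis
    by (rule finite_subset) (auto intro!: finite_imageI finite_PiE)
qed

lemma card_lattice_below: "card (lattice_below (n :: nat ^ 'd::finite)) = lattice_size n"
proof -
  \<comment> \<open>Points of the box are free choices of coordinates; the ranges start at 1 because
    lattice points are positive, so coordinate i has exactly \<open>n $ i\<close> values.\<close>
  have "bij_betw vec_nth (lattice_below n) (\<Pi>\<^sub>E i\<in>UNIV. {1..n $ i})"
    by (rule bij_betwI[where g = vec_lambda])
       (auto simp: lattice_below_def pos_lattice_def PiE_def Pi_def Suc_le_eq)
  then show ?thesis
    by (simp add: bij_betw_same_card card_PiE lattice_size_def)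
qed

lemma lattice_size_pos: "n \<in> pos_lattice \<Longrightarrow> lattice_size n > 0"
  by (auto simp: lattice_size_def pos_lattice_def intro!: prod_pos)

text \<open>The largest coordinate divides the positive product of all coordinates and hence is at
  most that product, so growth of a single coordinate suffices.\<close>

lemma filterlim_lattice_size: "filterlim (lattice_size :: nat ^ 'd::finite \<Rightarrow> nat) at_top max_at_top"
proof -
  have "filterlim (\<lambda>n :: nat ^ 'd. Max (range (\<lambda>i. n $ i))) at_top max_at_top"
    unfolding max_at_top_def by (rule filterlim_mono[OF filterlim_filtercomap]) auto
  moreover have "Max (range (\<lambda>i. n $ i)) \<le> lattice_size n" if n: "n \<in> pos_lattice" for n :: "nat ^ 'd"
  proof -
    have "Max (range (\<lambda>i. n $ i)) \<in> range (\<lambda>i. n $ i)"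
      by (rule Max_in) auto
    then obtain j where j: "Max (range (\<lambda>i. n $ i)) = n $ j" by (rule rangeE)
    have "n $ j dvd lattice_size n"
      unfolding lattice_size_def by (rule dvd_prodI) auto
    then show ?thesis
      using lattice_size_pos[OF n] j by (auto dest: dvd_imp_le)
  qed
  then have "eventually (\<lambda>n :: nat ^ 'd. Max (range (\<lambda>i. n $ i)) \<le> lattice_size n) max_at_top"
    by (auto simp: max_at_top_def eventually_inf_principal)
  ultimately show ?thesis
    by (rule filterlim_at_top_mono)
qed

section \<open>Trigonometric sums on the torus\<close>

lemma borel_measurable_lattice_dot [measurable]: "lattice_dot k \<in> borel_measurable borel"
  unfolding lattice_dot_def by measurable

lemma norm_trig_sum_le:
  "cmod (\<Sum>k\<in>K. exp (\<i> * complex_of_real (lattice_dot k t)) * complex_of_real (a k)) \<le> (\<Sum>k\<in>K. \<bar>a k\<bar>)"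
  by (rule order_trans[OF norm_sum]) (simp add: norm_mult)

lemma integrable_torus_character: "integrable (lebesgue_on torus) (character m)"
proof -
  interpret finite_measure "lebesgue_on (torus :: (real ^ 'd::finite) set)"
    by (rule finite_measure_torus)
  show ?thesis
    by (rule integrable_const_bound[where B = 1])
       (auto simp: character_def[abs_def] intro!: measurable_lebesgue_on_if_borel)
qed

text \<open>Parseval's identity: the square expands into a double sum of characters, and
  orthogonality leaves only the diagonal. The factor \<open>?V\<close> appears because the measure
  is not normalised.\<close>

lemma integral_torus_norm_square:
  fixes a :: "nat ^ 'd::finite \<Rightarrow> real"
  assumes "finite K"
  shows "(LINT t|lebesgue_on torus. (cmod (\<Sum>k\<in>K. exp (\<i> * complex_of_real (lattice_dot k t)) * complex_of_real (a k)))\<^sup>2)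
         = measure (lebesgue_on torus) (torus :: (real ^ 'd) set) * (\<Sum>k\<in>K. (a k)\<^sup>2)" (is "?L = ?V * _")
proof -
  \<comment> \<open>Frequency differences may be negative, hence the integer-valued vectors; zero
    frequency marks exactly the diagonal.\<close>
  define \<mu> where "\<mu> k l = (\<chi> i. int (k $ i) - int (l $ i))" for k l :: "nat ^ 'd"
  have \<mu>_0: "\<mu> k l = 0 \<longleftrightarrow> k = l" for k l
    by (auto simp: \<mu>_def vec_eq_iff)
  have char_0: "character (0 :: int ^ 'd) = (\<lambda>t. 1)"
    by (simp add: character_def[abs_def])
  have int: "(LINT t|lebesgue_on torus. character (\<mu> k l) t) = (if l = k then complex_of_real ?V else 0)" for k l
  proof (cases "k = l")
    case True
    then show ?thesis
      using \<mu>_0[of k l] by (simp add: char_0 scaleR_conv_of_real)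
  next
    case False
    then show ?thesis
      using \<mu>_0[of k l] by (simp add: integral_torus_character)
  qed
  have "exp (\<i> * complex_of_real (lattice_dot k t)) * cnj (exp (\<i> * complex_of_real (lattice_dot l t))) =
        character (\<mu> k l) t" for k l t
    unfolding cis_conv_exp[symmetric]
    by (simp add: character_def \<mu>_def lattice_dot_def cis_cnj cis_mult sum_subtractf left_diff_distrib)
  then have square: "complex_of_real ((cmod (\<Sum>k\<in>K. exp (\<i> * complex_of_real (lattice_dot k t)) * complex_of_real (a k)))\<^sup>2)
      = (\<Sum>k\<in>K. \<Sum>l\<in>K. complex_of_real (a k * a l) * character (\<mu> k l) t)" for t
    unfolding complex_norm_square cnj_sum sum_product
    by (intro sum.cong refl) (simp add: mult_ac)
  \<comment> \<open>The individual terms of the double sum are complex, so the computation runs in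
    the complex numbers and returns to the reals by injectivity of the embedding.\<close>
  have "complex_of_real ?L = (LINT t|lebesgue_on torus. (\<Sum>k\<in>K. \<Sum>l\<in>K. complex_of_real (a k * a l) * character (\<mu> k l) t))"
    by (simp only: integral_complex_of_real[symmetric] square)
  also have "\<dots> = (\<Sum>k\<in>K. \<Sum>l\<in>K. complex_of_real (a k * a l) * (LINT t|lebesgue_on torus. character (\<mu> k l) t))"
    by (simp add: Bochner_Integration.integral_sum integrable_torus_character del: of_real_mult)
  also have "\<dots> = (\<Sum>k\<in>K. complex_of_real (a k * a k) * complex_of_real ?V)"
    using \<open>finite K\<close> by (simp add: int if_distrib[of "\<lambda>x. _ * x"] sum.delta cong: if_cong)
  also have "\<dots> = complex_of_real (?V * (\<Sum>k\<in>K. (a k)\<^sup>2))"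
    by (simp add: power2_eq_square sum_distrib_left mult_ac)
  finally show ?thesis
    by (simp only: of_real_eq_iff)
qed

text \<open>The clamped coefficients are handled in mean square by Parseval, the excess by the
  triangle inequality. In \<open>1 + A\<^sup>2\<close> the 1 comes from the threshold
  \<open>s\<close> and the other term from the mean square divided by \<open>s\<close>.\<close>

lemma integral_torus_norm_le:
  fixes a :: "nat ^ 'd::finite \<Rightarrow> real"
  assumes "finite K" "K \<noteq> {}" "A \<ge> 0"
  shows "(LINT t|lebesgue_on torus. cmod (\<Sum>k\<in>K. exp (\<i> * complex_of_real (lattice_dot k t)) * complex_of_real (a k)))
         \<le> measure (lebesgue_on torus) (torus :: (real ^ 'd) set) *
            ((1 + A\<^sup>2) * sqrt (card K) + (\<Sum>k\<in>K. max 0 (\<bar>a k\<bar> - A)))"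
proof -
  let ?T = "lebesgue_on (torus :: (real ^ 'd) set)"
  let ?V = "measure ?T torus"
  define S where "S b t = (\<Sum>k\<in>K. exp (\<i> * complex_of_real (lattice_dot k t)) * complex_of_real (b k))"
    for b :: "nat ^ 'd \<Rightarrow> real" and t
  define c where "c k = max (- A) (min A (a k))" for k
  \<comment> \<open>This threshold balances the two terms: the mean square is at most
    \<open>?V * A\<^sup>2 * s * s\<close>, so dividing by \<open>s\<close> leaves the order of
    \<open>s\<close> itself.\<close>
  define s where "s = sqrt (card K)"
  have "s > 0" and s2: "s * s = card K"
    using assms by (auto simp: s_def card_gt_0_iff)
  interpret finite_measure ?T
    by (rule finite_measure_torus)
  have S_meas [measurable]: "S b \<in> borel_measurable ?T" for b
    unfolding S_def by (rule measurable_lebesgue_on_if_borel) measurable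
  have S_bound: "cmod (S b t) \<le> (\<Sum>k\<in>K. \<bar>b k\<bar>)" for b t
    unfolding S_def by (rule norm_trig_sum_le)
  have int1: "integrable ?T (\<lambda>t. cmod (S b t))" for b
    by (rule integrable_const_bound[where B = "\<Sum>k\<in>K. \<bar>b k\<bar>"]) (auto simp: S_bound)
  have int2: "integrable ?T (\<lambda>t. (cmod (S b t))\<^sup>2)" for b
    by (rule integrable_const_bound[where B = "(\<Sum>k\<in>K. \<bar>b k\<bar>)\<^sup>2"]) (auto simp: S_bound power_mono)
  have pointwise: "cmod (S a t) \<le> s + (cmod (S c t))\<^sup>2 / s + (\<Sum>k\<in>K. max 0 (\<bar>a k\<bar> - A))" for t
  proof -
    have "S a t = S c t + S (\<lambda>k. a k - c k) t"
      by (simp add: S_def flip: sum.distrib) (simp add: algebra_simps)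
    then have "cmod (S a t) \<le> cmod (S c t) + cmod (S (\<lambda>k. a k - c k) t)"
      by (simp add: norm_triangle_ineq)
    also have "cmod (S (\<lambda>k. a k - c k) t) \<le> (\<Sum>k\<in>K. \<bar>a k - c k\<bar>)"
      by (rule S_bound)
    also have "\<dots> = (\<Sum>k\<in>K. max 0 (\<bar>a k\<bar> - A))"
      using \<open>A \<ge> 0\<close> by (intro sum.cong) (auto simp: c_def max_def min_def)
    \<comment> \<open>In place of Cauchy-Schwarz: a nonnegative r is either at most s, or larger and
      then at most r * r / s.\<close>
    also have "cmod (S c t) \<le> s + (cmod (S c t))\<^sup>2 / s"
    proof (cases "cmod (S c t) \<le> s")
      case True
      with \<open>s > 0\<close> show ?thesis by (simp add: add_increasing2)
    next
      case False
      then have "cmod (S c t) * s \<le> (cmod (S c t))\<^sup>2"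
        by (simp add: power2_eq_square mult_left_mono)
      with \<open>s > 0\<close> have "cmod (S c t) \<le> (cmod (S c t))\<^sup>2 / s"
        by (simp add: field_simps)
      with \<open>s > 0\<close> show ?thesis by simp
    qed
    finally show ?thesis by simp
  qed
  have "(LINT t|?T. cmod (S a t)) \<le> (LINT t|?T. s + (cmod (S c t))\<^sup>2 / s + (\<Sum>k\<in>K. max 0 (\<bar>a k\<bar> - A)))"
    by (intro integral_mono pointwise int1 Bochner_Integration.integrable_add integrable_divide int2 integrable_const)
  also have "\<dots> = ?V * s + (LINT t|?T. (cmod (S c t))\<^sup>2) / s + ?V * (\<Sum>k\<in>K. max 0 (\<bar>a k\<bar> - A))"
    by (simp add: int2)
  also have "(LINT t|?T. (cmod (S c t))\<^sup>2) = ?V * (\<Sum>k\<in>K. (c k)\<^sup>2)"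
    unfolding S_def by (rule integral_torus_norm_square[OF \<open>finite K\<close>])
  also have "\<dots> \<le> ?V * (\<Sum>k\<in>K. A\<^sup>2)"
    using \<open>A \<ge> 0\<close> by (intro mult_left_mono sum_mono) (auto simp: c_def abs_le_square_iff[symmetric])
  also have "\<dots> = ?V * A\<^sup>2 * s * s"
    by (simp add: s2 mult_ac)
  finally show ?thesis
    using \<open>s > 0\<close> by (simp add: divide_right_mono S_def s_def algebra_simps)
qed

section \<open>Integrability over the probability space and its product with the torus\<close>

lemma integral_tail_sum_le:
  fixes Y :: "'k \<Rightarrow> 'a \<Rightarrow> real"
  assumes P: "prob_space P" and X: "integrable P X" and K: "finite K"
    and Y: "\<And>k. k \<in> K \<Longrightarrow> Y k \<in> borel_measurable P"
    and le: "\<And>x. x \<ge> 0 \<Longrightarrow> (\<Sum>k\<in>K. \<P>(\<omega> in P. \<bar>Y k \<omega>\<bar> > x)) \<le> C * \<P>(\<omega> in P. \<bar>X \<omega>\<bar> > x)"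
    and A: "A \<ge> 0" and C: "C \<ge> 0"
  shows "\<And>k. k \<in> K \<Longrightarrow> integrable P (\<lambda>\<omega>. max 0 (\<bar>Y k \<omega>\<bar> - A))"
    and "(\<Sum>k\<in>K. LINT \<omega>|P. max 0 (\<bar>Y k \<omega>\<bar> - A)) \<le> C * (LINT \<omega>|P. max 0 (\<bar>X \<omega>\<bar> - A))"
proof -
  interpret prob_space P by fact
  have [measurable]: "Y k \<in> borel_measurable P" if "k \<in> K" for k
    using Y[OF that] .
  have "integrable P (\<lambda>\<omega>. max 0 (\<bar>X \<omega>\<bar> - A))"
    using X by auto
  then have "(\<integral>\<^sup>+\<omega>. ennreal (\<bar>X \<omega>\<bar> - A) \<partial>P) = ennreal (LINT \<omega>|P. max 0 (\<bar>X \<omega>\<bar> - A))"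
    by (subst nn_integral_eq_integral[symmetric]) auto
  then have le': "(\<Sum>k\<in>K. \<integral>\<^sup>+\<omega>. ennreal (\<bar>Y k \<omega>\<bar> - A) \<partial>P) \<le> ennreal (C * (LINT \<omega>|P. max 0 (\<bar>X \<omega>\<bar> - A)))"
    using nn_integral_tail_sum_le[OF P _ Y le A C] X C by (auto simp: ennreal_mult)
  \<comment> \<open>\<open>Y k\<close> is only known to be measurable. Its expected excess is one
    nonnegative term of a sum with a finite bound, hence finite.\<close>
  show int: "integrable P (\<lambda>\<omega>. max 0 (\<bar>Y k \<omega>\<bar> - A))" if k: "k \<in> K" for k
  proof (rule integrableI_bounded)
    have "(\<integral>\<^sup>+\<omega>. ennreal (\<bar>Y k \<omega>\<bar> - A) \<partial>P) \<le> (\<Sum>k\<in>K. \<integral>\<^sup>+\<omega>. ennreal (\<bar>Y k \<omega>\<bar> - A) \<partial>P)"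
      by (rule member_le_sum[OF k _ K]) simp
    also note le'
    finally show "(\<integral>\<^sup>+\<omega>. ennreal (norm (max 0 (\<bar>Y k \<omega>\<bar> - A))) \<partial>P) < \<infinity>"
      by (simp add: le_less_trans)
  qed (use k in measurable)
  have "(\<Sum>k\<in>K. \<integral>\<^sup>+\<omega>. ennreal (\<bar>Y k \<omega>\<bar> - A) \<partial>P) = (\<Sum>k\<in>K. ennreal (LINT \<omega>|P. max 0 (\<bar>Y k \<omega>\<bar> - A)))"
    using int by (intro sum.cong) (auto simp flip: nn_integral_eq_integral)
  also have "\<dots> = ennreal (\<Sum>k\<in>K. LINT \<omega>|P. max 0 (\<bar>Y k \<omega>\<bar> - A))"
    by (rule sum_ennreal) simp
  finally show "(\<Sum>k\<in>K. LINT \<omega>|P. max 0 (\<bar>Y k \<omega>\<bar> - A)) \<le> C * (LINT \<omega>|P. max 0 (\<bar>X \<omega>\<bar> - A))"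
    using le' C by (simp add: ennreal_le_iff)
qed

text \<open>Each term of the finite sum has modulus |X_k|, constant in t, so over a torus of finite
  measure its integrability reduces to that of X_k.\<close>

lemma integrable_DFT:
  fixes Xs :: "nat ^ 'd::finite \<Rightarrow> 'a \<Rightarrow> real"
  assumes "prob_space P" and int: "\<And>k. k \<in> pos_lattice \<Longrightarrow> integrable P (Xs k)"
  shows "integrable (torus_product P) (\<lambda>(\<omega>, t). DFT Xs n \<omega> t)"
proof -
  let ?T = "lebesgue_on (torus :: (real ^ 'd) set)"
  interpret prob_space P by fact
  interpret T: finite_measure ?T
    by (rule finite_measure_torus)
  interpret pair_sigma_finite P ?T ..
  have "integrable (P \<Otimes>\<^sub>M ?T) (\<lambda>(\<omega>, t). exp (\<i> * complex_of_real (lattice_dot k t)) * complex_of_real (Xs k \<omega>))"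
    if k: "k \<in> lattice_below n" for k
  proof (rule Fubini_integrable)
    have Xk: "integrable P (Xs k)"
      using k int by (simp add: lattice_below_def)
    then have [measurable]: "Xs k \<in> borel_measurable P" by simp
    have [measurable]: "lattice_dot k \<in> borel_measurable ?T"
      by (rule measurable_lebesgue_on_if_borel) simp
    show "(\<lambda>(\<omega>, t). exp (\<i> * complex_of_real (lattice_dot k t)) * complex_of_real (Xs k \<omega>)) \<in> borel_measurable (P \<Otimes>\<^sub>M ?T)"
      by measurable
    show "integrable P (\<lambda>\<omega>. LINT t|?T. cmod (case (\<omega>, t) of (\<omega>, t) \<Rightarrow>
            exp (\<i> * complex_of_real (lattice_dot k t)) * complex_of_real (Xs k \<omega>)))"
      using Xk by (simp add: norm_mult)
    show "AE \<omega> in P. integrable ?T (\<lambda>t. case (\<omega>, t) of (\<omega>, t) \<Rightarrow>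
            exp (\<i> * complex_of_real (lattice_dot k t)) * complex_of_real (Xs k \<omega>))"
      by (intro AE_I2 T.integrable_const_bound[where B = "\<bar>Xs k _\<bar>"]) (auto simp: norm_mult)
  qed
  then show ?thesis
    unfolding torus_product_def DFT_def case_prod_unfold
    by (intro Bochner_Integration.integrable_sum)
qed

section \<open>Convergence in the L_1-norm on the product space\<close>

theorem theorem3p1:
  fixes P :: "'a measure"
    and X :: "'a \<Rightarrow> real"
    and Xs :: "nat ^ 'd::finite \<Rightarrow> 'a \<Rightarrow> real"
    and M :: real
  assumes "prob_space P"
    and "X \<in> borel_measurable P"
    and "\<And>n. n \<in> pos_lattice \<Longrightarrow> Xs n \<in> borel_measurable P"
    and "M > 0"
    and "\<And>x n. x \<ge> 0 \<Longrightarrow> n \<in> pos_lattice \<Longrightarrow>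
           1 / real (lattice_size n) * (\<Sum>k\<in>lattice_below n. \<P>(\<omega> in P. \<bar>Xs k \<omega>\<bar> > x))
             \<le> M * \<P>(\<omega> in P. \<bar>X \<omega>\<bar> > x)"
    and "integrable P X"
  shows "(\<forall>n\<in>pos_lattice. integrable (torus_product P)
            (\<lambda>(\<omega>, t). DFT Xs n \<omega> t / of_nat (lattice_size n))) \<and>
         ((\<lambda>n. LINT (\<omega>, t)|torus_product P. cmod (DFT Xs n \<omega> t) / real (lattice_size n))
            \<longlongrightarrow> 0) max_at_top"
proof -
  let ?T = "lebesgue_on (torus :: (real ^ 'd) set)"
  let ?V = "measure ?T torus"
  let ?N = "\<lambda>n. real (lattice_size n)"
  let ?F = "\<lambda>n. LINT (\<omega>, t)|torus_product P. cmod (DFT Xs n \<omega> t) / ?N n"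
  let ?\<tau> = "\<lambda>A. LINT \<omega>|P. max 0 (\<bar>X \<omega>\<bar> - A)"
  interpret prob_space P by fact
  interpret T: finite_measure ?T
    by (rule finite_measure_torus)
  interpret pair_sigma_finite P ?T ..
  have le: "(\<Sum>k\<in>lattice_below n. \<P>(\<omega> in P. \<bar>Xs k \<omega>\<bar> > x)) \<le> (M * ?N n) * \<P>(\<omega> in P. \<bar>X \<omega>\<bar> > x)"
    if "n \<in> pos_lattice" "x \<ge> 0" for n x
    using assms(5)[OF that(2,1)] lattice_size_pos[OF that(1)] by (simp add: field_simps)
  have meas: "Xs k \<in> borel_measurable P" if "k \<in> lattice_below n" for k n
    using that assms(3) by (simp add: lattice_below_def)
  note tail = integral_tail_sum_le[OF \<open>prob_space P\<close> \<open>integrable P X\<close> finite_lattice_below]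
  have Xs_int: "integrable P (Xs k)" if k: "k \<in> pos_lattice" for k
  proof -
    have "k \<in> lattice_below k"
      using k by (simp add: lattice_below_def)
    \<comment> \<open>At level A = 0 the excess is |X_k| itself, and k lies in its own box, so the
      tail hypothesis for n = k already yields integrability.\<close>
    from tail(1)[OF meas le[OF k] _ _ this, where A = 0] have "integrable P (\<lambda>\<omega>. \<bar>Xs k \<omega>\<bar>)"
      using \<open>M > 0\<close> by simp
    then show ?thesis
      using assms(3)[OF k] by (rule integrable_abs_cancel)
  qed
  \<comment> \<open>This gives the limit its content: \<open>LINT\<close> is 0 by default on
    functions that are not integrable. It also licenses Fubini.\<close>
  have DFT_int: "integrable (torus_product P) (\<lambda>(\<omega>, t). DFT Xs n \<omega> t)" for n
    using \<open>prob_space P\<close> Xs_int by (rule integrable_DFT)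
  \<comment> \<open>The dependence on n and on A separates: for fixed A the first summand vanishes
    as n grows, while the second does not involve n.\<close>
  have bound: "?F n \<le> ?V * (1 + A\<^sup>2) / sqrt (?N n) + ?V * M * ?\<tau> A"
    if n: "n \<in> pos_lattice" and "A \<ge> 0" for n :: "nat ^ 'd" and A :: real
  proof -
    note N_pos = lattice_size_pos[OF n]
    have fin: "finite (lattice_below n)"
      by (rule finite_lattice_below)
    have ne: "lattice_below n \<noteq> {}"
      using N_pos card_lattice_below[of n] by auto
    have tail_int: "integrable P (\<lambda>\<omega>. max 0 (\<bar>Xs k \<omega>\<bar> - A))" if "k \<in> lattice_below n" for k
      using Xs_int that by (auto simp: lattice_below_def)
    have int: "integrable (P \<Otimes>\<^sub>M ?T) (\<lambda>(\<omega>, t). cmod (DFT Xs n \<omega> t) / ?N n)"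
      using integrable_norm[OF DFT_int[of n]]
      by (auto simp: torus_product_def case_prod_unfold)
    have "?F n = (LINT \<omega>|P. LINT t|?T. cmod (DFT Xs n \<omega> t) / ?N n)"
      unfolding torus_product_def by (rule integral_fst[OF int, symmetric])
    \<comment> \<open>The torus estimate is applied for each fixed \<omega> with coefficients
      X_k(\<omega>); the number of terms is \<open>lattice_size n\<close>.\<close>
    also have "\<dots> \<le> (LINT \<omega>|P. ?V * ((1 + A\<^sup>2) * sqrt (?N n) + (\<Sum>k\<in>lattice_below n. max 0 (\<bar>Xs k \<omega>\<bar> - A))) / ?N n)"
    proof (rule integral_mono)
      show "integrable P (\<lambda>\<omega>. LINT t|?T. cmod (DFT Xs n \<omega> t) / ?N n)"
        by (rule integrable_fst[OF int])
      show "integrable P (\<lambda>\<omega>. ?V * ((1 + A\<^sup>2) * sqrt (?N n) + (\<Sum>k\<in>lattice_below n. max 0 (\<bar>Xs k \<omega>\<bar> - A))) / ?N n)"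
        using tail_int by simp
      show "(LINT t|?T. cmod (DFT Xs n \<omega> t) / ?N n) \<le>
            ?V * ((1 + A\<^sup>2) * sqrt (?N n) + (\<Sum>k\<in>lattice_below n. max 0 (\<bar>Xs k \<omega>\<bar> - A))) / ?N n" for \<omega>
        using integral_torus_norm_le[OF fin ne \<open>A \<ge> 0\<close>, of "\<lambda>k. Xs k \<omega>"]
        by (simp add: DFT_def card_lattice_below divide_right_mono)
    qed
    also have "\<dots> = ?V * ((1 + A\<^sup>2) * sqrt (?N n) + (\<Sum>k\<in>lattice_below n. LINT \<omega>|P. max 0 (\<bar>Xs k \<omega>\<bar> - A))) / ?N n"
      using tail_int by (simp add: Bochner_Integration.integral_sum prob_space)
    also have "\<dots> \<le> ?V * ((1 + A\<^sup>2) * sqrt (?N n) + M * ?N n * ?\<tau> A) / ?N n"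
      using tail(2)[OF meas le[OF n] \<open>A \<ge> 0\<close>] \<open>M > 0\<close>
      by (intro divide_right_mono mult_left_mono add_left_mono) auto
    also have "\<dots> = ?V * (1 + A\<^sup>2) * (sqrt (?N n) / ?N n) + ?V * M * ?\<tau> A"
      using N_pos by (simp add: field_simps)
    also have "sqrt (?N n) / ?N n = 1 / sqrt (?N n)"
      using N_pos by (simp add: field_simps)
    finally show ?thesis by simp
  qed
  have "(?F \<longlongrightarrow> 0) max_at_top"
  proof (rule tendstoI)
    fix e :: real assume "e > 0"
    \<comment> \<open>The truncation level m is fixed first, making the n-independent summand less
      than e / 2; only then does n grow.\<close>
    have "(\<lambda>m. ?V * M * ?\<tau> (real m)) \<longlonglongrightarrow> ?V * M * 0"
      by (intro tendsto_intros tendsto_tail_expectation \<open>integrable P X\<close>)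
    then have "eventually (\<lambda>m. ?V * M * ?\<tau> (real m) < e / 2) sequentially"
      using \<open>e > 0\<close> by (intro order_tendstoD(2)) auto
    then obtain m where m: "?V * M * ?\<tau> (real m) < e / 2"
      by (auto simp: eventually_sequentially)
    \<comment> \<open>With m fixed the remaining summand depends on n only through its size N, so a
      sequential limit composes with the growth of \<open>lattice_size\<close>.\<close>
    have "((\<lambda>N. ?V * (1 + (real m)\<^sup>2) / sqrt (real N)) \<longlongrightarrow> 0) sequentially"
      by (intro tendsto_divide_0[OF tendsto_const] filterlim_at_top_imp_at_infinity
            filterlim_compose[OF sqrt_at_top filterlim_real_sequentially])
    from filterlim_compose[OF this filterlim_lattice_size]
    have "((\<lambda>n :: nat ^ 'd. ?V * (1 + (real m)\<^sup>2) / sqrt (?N n)) \<longlongrightarrow> 0) max_at_top" .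
    then have "eventually (\<lambda>n :: nat ^ 'd. ?V * (1 + (real m)\<^sup>2) / sqrt (?N n) < e / 2) max_at_top"
      using \<open>e > 0\<close> by (intro order_tendstoD(2)) auto
    moreover have "eventually (\<lambda>n :: nat ^ 'd. n \<in> pos_lattice) max_at_top"
      by (simp add: max_at_top_def eventually_inf_principal)
    ultimately show "eventually (\<lambda>n. dist (?F n) 0 < e) max_at_top"
    proof eventually_elim
      case (elim n)
      \<comment> \<open>Nonnegativity turns the distance to 0 into the integral itself, so the upper
        bound suffices.\<close>
      have "?F n \<ge> 0"
        by (rule Bochner_Integration.integral_nonneg) (auto simp: case_prod_unfold)
      moreover have "?F n < e / 2 + e / 2"
        using bound[OF elim(2) of_nat_0_le_iff[of m]] add_strict_mono[OF elim(1) m]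
        by (rule le_less_trans)
      ultimately show ?case
        by simp
    qed
  qed
  then show ?thesis
    using DFT_int by (auto simp: case_prod_unfold)
qed

end
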